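(* Let $n$ be a positive even integer and let $\mathbb{T}^n = (S^1)^n$ be the $n$-dimensional torus, a topological group under coordinatewise multiplication with the product topology. Then there exist continuous inverse ambiguous functions $f : \mathbb{T}^n \to \mathbb{T}^n$.
   Context: For a group $G$, a function $f : G \to G$ is called inverse ambiguous if it is bijective and its inverse function satisfies $f^{-1}(x) = (f(x))^{-1}$ for all $x \in G$, where the right-hand side is the group inverse of $f(x)$. Equivalently, $f(f(x)) = x^{-1}$ for all $x \in G$. Here $S^1 = \{z \in \mathbb{C} : |z| = 1\}$ is the circle group under multiplication. *)

theory Defs
  imports "HOL-Analysis.Analysis" "HOL-Algebra.Product_Groups"
begin

definition circle_group :: "complex monoid" where
  "circle_group = \<lparr>carrier = sphere 0 1, mult = (*), one = 1\<rparr>"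

text \<open>Points of the torus are extensional functions on \<open>{..<n}\<close>, i.e. they take the value
  \<^term>\<open>undefined\<close> outside \<open>{..<n}\<close>, so that each point has exactly one representative.\<close>

definition torus_group :: "nat \<Rightarrow> (nat \<Rightarrow> complex) monoid" where
  "torus_group n = product_group {..<n} (\<lambda>_. circle_group)"

definition torus_topology :: "nat \<Rightarrow> (nat \<Rightarrow> complex) topology" where
  "torus_topology n = product_topology (\<lambda>_. top_of_set (sphere 0 1)) {..<n}"

definition inverse_ambiguous :: "('a, 'b) monoid_scheme \<Rightarrow> ('a \<Rightarrow> 'a) \<Rightarrow> bool" where
  "inverse_ambiguous G f \<longleftrightarrow>
     bij_betw f (carrier G) (carrier G) \<and>
     (\<forall>x\<in>carrier G. inv_into (carrier G) f x = inv\<^bsub>G\<^esub> (f x))"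

lemma group_circle_group: "group circle_group"
proof (rule groupI)
  fix x assume x: "x \<in> carrier circle_group"
  then have "x \<noteq> 0" by (auto simp: circle_group_def)
  with x show "\<exists>y\<in>carrier circle_group. y \<otimes>\<^bsub>circle_group\<^esub> x = \<one>\<^bsub>circle_group\<^esub>"
    by (intro bexI[of _ "inverse x"]) (auto simp: circle_group_def norm_inverse)
qed (auto simp: circle_group_def norm_mult)

lemma group_torus_group: "group (torus_group n)"
  by (simp add: torus_group_def group_circle_group)

lemma topspace_torus_topology: "topspace (torus_topology n) = carrier (torus_group n)"
  by (simp add: torus_topology_def torus_group_def circle_group_def)


end

theory Submission imports Defs
begin

text \<open>A map whose square is group inversion is already inverse ambiguous, so a continuous
  square root of inversion suffices. On the torus of rank 2 the quarter turn sending (z, w) to (w,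
  1/z) is one, like multiplication by i as a square root of -1. Since \<open>n\<close> is even, the
  coordinates split into pairs and the quarter turn acts on each. The lemmas
  \<open>torus_quarter_turn_square\<close> and \<open>continuous_map_torus_quarter_turn\<close>
  supply the two properties.\<close>

text \<open>From the square being inversion, the fourth power of \<open>f\<close> is the identity,
  so \<open>f\<close> is bijective with inverse its cube, which is inversion after \<open>f\<close>.
  No homomorphism property of \<open>f\<close> enters.\<close>

lemma inverse_ambiguousI:
  assumes "group G"
    and closed: "\<And>x. x \<in> carrier G \<Longrightarrow> f x \<in> carrier G"
    and square: "\<And>x. x \<in> carrier G \<Longrightarrow> f (f x) = inv\<^bsub>G\<^esub> x"
  shows "inverse_ambiguous G f"
proof -
  interpret group G by fact
  \<comment> \<open>Reading \<open>square\<close> backwards at \<open>f x\<close> turns the left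
    side into four applications of \<open>f\<close>, that is, a double inverse.\<close>
  have right_inv: "f (inv\<^bsub>G\<^esub> (f x)) = x" if "x \<in> carrier G" for x
    using that closed square by (metis inv_inv)
  have bij: "bij_betw f (carrier G) (carrier G)"
  proof (rule bij_betw_byWitness[where f' = "\<lambda>x. inv\<^bsub>G\<^esub> (f x)"])
    show "\<forall>x\<in>carrier G. inv\<^bsub>G\<^esub> (f (f x)) = x"
      by (simp add: square)
  qed (use right_inv closed in auto)
  have "inv_into (carrier G) f x = inv\<^bsub>G\<^esub> (f x)" if "x \<in> carrier G" for x
    by (rule inv_into_f_eq) (use bij right_inv closed that in \<open>auto simp: bij_betw_def\<close>)
  with bij show ?thesis
    by (simp add: inverse_ambiguous_def)
qed

lemma inv_circle_group:
  assumes "z \<in> carrier circle_group"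
  shows "inv\<^bsub>circle_group\<^esub> z = inverse z"
proof (rule group.inv_equality[OF group_circle_group])
  have "z \<noteq> 0" using assms by (auto simp: circle_group_def)
  then show "inverse z \<otimes>\<^bsub>circle_group\<^esub> z = \<one>\<^bsub>circle_group\<^esub>"
    by (simp add: circle_group_def)
qed (use assms in \<open>auto simp: circle_group_def norm_inverse\<close>)

lemma inv_torus_group:
  assumes "x \<in> carrier (torus_group n)"
  shows "inv\<^bsub>torus_group n\<^esub> x = (\<lambda>i\<in>{..<n}. inverse (x i))"
  using assms
  by (auto simp: torus_group_def group_circle_group inv_circle_group PiE_iff intro!: restrict_ext)

text \<open>On each pair of coordinates \<open>(2k, 2k + 1)\<close> this is the quarter turn
  \<open>(z, w) \<mapsto> (w, z\<^sup>-\<^sup>1)\<close>, whose square is inversion.\<close>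

definition torus_quarter_turn :: "nat \<Rightarrow> (nat \<Rightarrow> complex) \<Rightarrow> nat \<Rightarrow> complex" where
  "torus_quarter_turn n x =
     (\<lambda>i\<in>{..<n}. if even i then x (Suc i) else inverse (x (i - 1)))"

text \<open>This is where the parity of \<open>n\<close> enters: every even index has its partner
  inside the range, so the quarter turn never reads an \<open>undefined\<close> coordinate.\<close>

lemma Suc_less_even:
  fixes i n :: nat
  assumes "even n" "even i" "i < n"
  shows "Suc i < n"
  using assms by (metis Suc_lessI even_Suc)

lemma torus_quarter_turn_closed:
  assumes "even n" "x \<in> carrier (torus_group n)"
  shows "torus_quarter_turn n x \<in> carrier (torus_group n)"
  using assms
  by (auto simp: torus_quarter_turn_def torus_group_def circle_group_def PiE_iff norm_inverse
      Suc_less_even)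

text \<open>Two applications lead each index to its partner and back, passing exactly one odd index,
  so each coordinate is inverted exactly once.\<close>

lemma torus_quarter_turn_square:
  assumes "even n" "x \<in> carrier (torus_group n)"
  shows "torus_quarter_turn n (torus_quarter_turn n x) = inv\<^bsub>torus_group n\<^esub> x"
  unfolding inv_torus_group[OF assms(2)]
  using assms(1) by (auto simp: torus_quarter_turn_def Suc_less_even fun_eq_iff)

lemma continuous_map_torus_quarter_turn:
  assumes "even n"
  shows "continuous_map (torus_topology n) (torus_topology n) (torus_quarter_turn n)"
proof -
  let ?S = "top_of_set (sphere 0 1 :: complex set)"
  have inverse: "continuous_map ?S ?S inverse"
    by (auto simp: norm_inverse intro!: continuous_intros)
  have proj: "continuous_map (torus_topology n) ?S (\<lambda>x. x i)" if "i < n" for i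
    unfolding torus_topology_def by (rule continuous_map_product_projection) (use that in simp)
  have "continuous_map (torus_topology n) ?S (\<lambda>x. torus_quarter_turn n x i)" if "i < n" for i
  proof (cases "even i")
    case True
    then show ?thesis
      using proj[OF Suc_less_even[OF assms True that]] that by (simp add: torus_quarter_turn_def)
  next
    case False
    have "continuous_map (torus_topology n) ?S (inverse \<circ> (\<lambda>x. x (i - 1)))"
      by (rule continuous_map_compose[OF proj inverse]) (use that in simp)
    with False that show ?thesis
      by (simp add: torus_quarter_turn_def comp_def)
  qed
  \<comment> \<open>Continuity into a product topology also requires extensional values, besides
    continuous coordinates.\<close>
  moreover have "torus_quarter_turn n x \<in> extensional {..<n}" for x
    by (simp add: torus_quarter_turn_def)
  ultimately show ?thesis
    unfolding torus_topology_def[of n] continuous_map_componentwise by auto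
qed

theorem theorem2p4:
  fixes n :: nat
  assumes "n > 0" and "even n"
  shows "\<exists>f. continuous_map (torus_topology n) (torus_topology n) f \<and>
             inverse_ambiguous (torus_group n) f"
  using continuous_map_torus_quarter_turn[OF assms(2)]
    inverse_ambiguousI[OF group_torus_group torus_quarter_turn_closed[OF assms(2)]
      torus_quarter_turn_square[OF assms(2)]]
  by blast

end
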